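(* The diameter of the graph $\Gamma_C^Z(\mathbb{S})$ equals $3$.
   Context: Cayley--Dickson process over $\mathbb{R}$: given a unital real algebra $\mathcal{A}$ with involution $a\mapsto\bar a$, the algebra $\mathcal{A}\{-1\}$ is the vector space $\mathcal{A}\times\mathcal{A}$ with multiplication $(a,b)(c,d)=(ac-\bar d b,\; da+b\bar c)$ and involution $\overline{(a,b)}=(\bar a,-b)$. Put $\mathcal{M}_0=\mathbb{R}$ with trivial involution and $\mathcal{M}_{n+1}=\mathcal{M}_n\{-1\}$. Then $\mathbb{O}=\mathcal{M}_3$ is the algebra of real octonions and $\mathbb{S}=\mathcal{M}_4=\mathbb{O}\{-1\}$ is the ($16$-dimensional) algebra of real sedenions. $\mathbb{R}$ is identified with the multiples of the unity of $\mathbb{S}$; the commutative center of $\mathbb{S}$ (the set of elements commuting with every element of $\mathbb{S}$) is $\mathbb{R}$. $Z(\mathbb{S})$ is the set of zero divisors of $\mathbb{S}$ (left, right, or two-sided), i.e. nonzero elements $a\in\mathbb{S}$ for which there is a nonzero $b\in\mathbb{S}$ with $ab=0$ or $ba=0$. The commutativity graph $\Gamma_C(\mathbb{S})$ is the undirected graph without loops whose vertices are the subspaces $\mathbb{R}a+\mathbb{R}$ with $a\in\mathbb{S}\setminus\mathbb{R}$ (equivalently, lines in $\mathbb{S}/\mathbb{R}$), where two distinct vertices $\mathbb{R}a+\mathbb{R}$ and $\mathbb{R}b+\mathbb{R}$ are adjacent if and only if $ab=ba$ (this is well defined). $\Gamma_C^Z(\mathbb{S})$ is the (induced) subgraph of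 $\Gamma_C(\mathbb{S})$ on the vertex set $\{\mathbb{R}a+\mathbb{R} \mid a\in Z(\mathbb{S})\}$. The diameter of a graph $\Gamma$ is $\sup_{x,y\in\Gamma} d(x,y)$, where $d(x,y)$ is the length of a shortest path between $x$ and $y$ ($\infty$ if there is none). *)

theory Defs
  imports "HOL-Analysis.Analysis" "Graph_Theory.Graph_Theory"
begin

section \<open>The Cayley--Dickson process\<close>

text \<open>
  Unital, not necessarily associative, real algebras with involution. The library classes
  \<^class>\<open>real_algebra_1\<close> and \<^class>\<open>ring_1\<close> are associative, hence the separate class.
\<close>

class involutive_algebra = real_vector + times + one +
  fixes invol :: "'a \<Rightarrow> 'a"
  assumes ia_distrib_left: "a * (b + c) = a * b + a * c"
    and ia_distrib_right: "(a + b) * c = a * c + b * c"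
    and ia_scaleR_left: "(r *\<^sub>R a) * b = r *\<^sub>R (a * b)"
    and ia_scaleR_right: "a * (r *\<^sub>R b) = r *\<^sub>R (a * b)"
    and ia_one_left: "1 * a = a"
    and ia_one_right: "a * 1 = a"
    and invol_add: "invol (a + b) = invol a + invol b"
    and invol_scaleR: "invol (r *\<^sub>R a) = r *\<^sub>R invol a"
    and invol_mult: "invol (a * b) = invol b * invol a"
    and invol_invol: "invol (invol a) = a"

lemma ia_zero_left: "0 * (a::'a::involutive_algebra) = 0"
  using ia_scaleR_left[of 0 0 a] by simp

lemma ia_zero_right: "(a::'a::involutive_algebra) * 0 = 0"
  using ia_scaleR_right[of a 0 0] by simp

lemma ia_minus_left: "(- (a::'a::involutive_algebra)) * b = - (a * b)"
  using ia_scaleR_left[of "-1" a b] by simp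

lemma ia_minus_right: "(a::'a::involutive_algebra) * (- b) = - (a * b)"
  using ia_scaleR_right[of a "-1" b] by simp

lemma ia_diff_left: "((a::'a::involutive_algebra) - b) * c = a * c - b * c"
  using ia_distrib_right[of a "- b" c] by (simp add: ia_minus_left)

lemma ia_diff_right: "(a::'a::involutive_algebra) * (b - c) = a * b - a * c"
  using ia_distrib_left[of a b "- c"] by (simp add: ia_minus_right)

lemma invol_zero: "invol (0::'a::involutive_algebra) = 0"
  using invol_scaleR[of 0 "0::'a"] by simp

lemma invol_minus: "invol (- a) = - invol a"
  using invol_scaleR[of "-1" a] by simp

lemma invol_diff: "invol (a - b) = invol a - invol b"
  using invol_add[of a "- b"] by (simp add: invol_minus)

lemma invol_one: "invol (1::'a::involutive_algebra) = 1"
  using invol_mult[of 1 "invol (1::'a)"] by (simp add: ia_one_left ia_one_right invol_invol)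

lemmas ia_simps =
  ia_distrib_left ia_distrib_right ia_scaleR_left ia_scaleR_right ia_one_left ia_one_right
  ia_zero_left ia_zero_right ia_minus_left ia_minus_right ia_diff_left ia_diff_right
  invol_add invol_scaleR invol_mult invol_invol invol_zero invol_minus invol_diff invol_one

instantiation real :: involutive_algebra
begin

definition invol_real :: "real \<Rightarrow> real" where "invol_real a = a"

instance
  by standard (simp_all add: invol_real_def algebra_simps)

end

text \<open>The underlying vector space of the doubled algebra $\mathcal{A}\{-1\}$.\<close>

datatype 'a cd = CD (cd1: 'a) (cd2: 'a)

instantiation cd :: (involutive_algebra) involutive_algebra
begin

definition zero_cd :: "'a cd" where "0 = CD 0 0"
definition plus_cd :: "'a cd \<Rightarrow> 'a cd \<Rightarrow> 'a cd" where
  "x + y = CD (cd1 x + cd1 y) (cd2 x + cd2 y)"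
definition minus_cd :: "'a cd \<Rightarrow> 'a cd \<Rightarrow> 'a cd" where
  "x - y = CD (cd1 x - cd1 y) (cd2 x - cd2 y)"
definition uminus_cd :: "'a cd \<Rightarrow> 'a cd" where
  "- x = CD (- cd1 x) (- cd2 x)"
definition scaleR_cd :: "real \<Rightarrow> 'a cd \<Rightarrow> 'a cd" where
  "r *\<^sub>R x = CD (r *\<^sub>R cd1 x) (r *\<^sub>R cd2 x)"
definition one_cd :: "'a cd" where "1 = CD 1 0"
fun times_cd :: "'a cd \<Rightarrow> 'a cd \<Rightarrow> 'a cd" where
  "CD a b * CD c d = CD (a * c - invol d * b) (d * a + b * invol c)"
fun invol_cd :: "'a cd \<Rightarrow> 'a cd" where
  "invol (CD a b) = CD (invol a) (- b)"

instance
proof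
  fix a b c :: "'a cd" and r s :: real
  note defs = zero_cd_def plus_cd_def minus_cd_def uminus_cd_def scaleR_cd_def one_cd_def
  show "a + b + c = a + (b + c)" "a + b = b + a" "0 + a = a" "- a + a = 0" "a - b = a + - b"
    by (simp_all add: defs)
  show "r *\<^sub>R (a + b) = r *\<^sub>R a + r *\<^sub>R b" "(r + s) *\<^sub>R a = r *\<^sub>R a + s *\<^sub>R a"
    "r *\<^sub>R s *\<^sub>R a = (r * s) *\<^sub>R a" "1 *\<^sub>R a = a"
    by (simp_all add: defs scaleR_add_right scaleR_add_left)
  obtain a1 a2 b1 b2 c1 c2 where abc: "a = CD a1 a2" "b = CD b1 b2" "c = CD c1 c2"
    by (metis cd.exhaust)
  show "a * (b + c) = a * b + a * c" "(a + b) * c = a * c + b * c"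
    "(r *\<^sub>R a) * b = r *\<^sub>R (a * b)" "a * (r *\<^sub>R b) = r *\<^sub>R (a * b)"
    "1 * a = a" "a * 1 = a"
    "invol (a + b) = invol a + invol b" "invol (r *\<^sub>R a) = r *\<^sub>R invol a"
    "invol (a * b) = invol b * invol a" "invol (invol a) = a"
    unfolding abc
    by (simp_all add: defs ia_simps scaleR_diff_right scaleR_add_right)
qed

end

type_synonym octonion = "real cd cd cd"
type_synonym sedenion = "octonion cd"

section \<open>Scalars and zero divisors\<close>

definition scalars :: "'a::involutive_algebra set" where
  "scalars = {r *\<^sub>R 1 | r. True}"

text \<open>Left, right or two-sided; \<^term>\<open>0\<close> itself is excluded.\<close>

definition zero_divisors :: "'a::involutive_algebra set" where
  "zero_divisors = {a. a \<noteq> 0 \<and> (\<exists>b. b \<noteq> 0 \<and> (a * b = 0 \<or> b * a = 0))}"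

text \<open>The subspace $\mathbb{R}a+\mathbb{R}$.\<close>

definition vertex_of :: "'a::involutive_algebra \<Rightarrow> 'a set" where
  "vertex_of a = {r *\<^sub>R a + s *\<^sub>R 1 | r s. True}"

section \<open>Commutativity graphs\<close>

text \<open>Undirected loop-free graphs are rendered as symmetric loop-free digraphs.\<close>

type_synonym 'a subspace_graph = "('a set, 'a set \<times> 'a set) pre_digraph"

definition commutativity_graph :: "'a::involutive_algebra subspace_graph" where
  "commutativity_graph =
    \<lparr> verts = vertex_of ` (- scalars),
      arcs = {(vertex_of a, vertex_of b) | a b.
        a \<notin> scalars \<and> b \<notin> scalars \<and> vertex_of a \<noteq> vertex_of b \<and> a * b = b * a},
      tail = fst, head = snd \<rparr>"

definition zd_commutativity_graph :: "'a::involutive_algebra subspace_graph" where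
  "zd_commutativity_graph = induce_subgraph commutativity_graph (vertex_of ` zero_divisors)"

text \<open>
  With unit arc costs, the shortest-path distance \<^const>\<open>wf_digraph.\<mu>\<close> is the length of a shortest walk,
  and \<^term>\<open>\<infinity>\<close> if there is none.
\<close>

definition diameter :: "('v, 'e) pre_digraph \<Rightarrow> ereal" where
  "diameter G = (SUP x \<in> verts G. SUP y \<in> verts G. wf_digraph.\<mu> G (\<lambda>_. 1) x y)"

lemma zero_divisors_not_scalars: "zero_divisors \<subseteq> - scalars"
  by (auto simp: zero_divisors_def scalars_def ia_simps)

lemma commute_if_same_vertices:
  fixes a b a' b' :: "'a::involutive_algebra"
  assumes "vertex_of a = vertex_of a'" "vertex_of b = vertex_of b'" "a * b = b * a"
  shows "a' * b' = b' * a'"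
proof -
  have self: "x \<in> vertex_of x" for x :: 'a
    unfolding vertex_of_def by (rule CollectI, rule exI[of _ 1], rule exI[of _ 0]) simp
  have "a' \<in> vertex_of a" "b' \<in> vertex_of b"
    using self assms(1,2) by auto
  then obtain r s t u where "a' = r *\<^sub>R a + s *\<^sub>R 1" "b' = t *\<^sub>R b + u *\<^sub>R 1"
    unfolding vertex_of_def by blast
  then show ?thesis
    using assms(3) by (simp add: ia_simps algebra_simps)
qed

lemma adjacent_iff:
  fixes a b :: "'a::involutive_algebra"
  assumes "a \<notin> scalars" "b \<notin> scalars"
  shows "vertex_of a \<rightarrow>\<^bsub>commutativity_graph\<^esub> vertex_of b \<longleftrightarrow>
    vertex_of a \<noteq> vertex_of b \<and> a * b = b * a"
  (is "?L = ?R")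
proof
  assume ?L
  then obtain a' b' where "vertex_of a = vertex_of a'" "vertex_of b = vertex_of b'"
      "vertex_of a' \<noteq> vertex_of b'" "a' * b' = b' * a'"
    by (auto simp: commutativity_graph_def arcs_ends_conv)
  then show ?R
    using commute_if_same_vertices[of a' a b' b] by simp
next
  assume ?R
  with assms have "(vertex_of a, vertex_of b) \<in> arcs commutativity_graph"
    unfolding commutativity_graph_def by auto
  then show ?L
    by (force simp: commutativity_graph_def arcs_ends_conv)
qed

lemma wf_commutativity_graph: "wf_digraph commutativity_graph"
  by unfold_locales (auto simp: commutativity_graph_def)

lemma loopfree_commutativity_graph: "loopfree_digraph commutativity_graph"
  by unfold_locales (auto simp: commutativity_graph_def)

lemma symmetric_commutativity_graph: "symmetric (commutativity_graph :: 'a::involutive_algebra subspace_graph)"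
  unfolding symmetric_conv
proof
  fix e :: "'a set \<times> 'a set"
  assume "e \<in> arcs commutativity_graph"
  then obtain a b :: 'a where "e = (vertex_of a, vertex_of b)" "a \<notin> scalars" "b \<notin> scalars"
      "vertex_of a \<noteq> vertex_of b" "a * b = b * a"
    unfolding commutativity_graph_def by auto
  then have "(vertex_of b, vertex_of a) \<in> arcs commutativity_graph"
    unfolding commutativity_graph_def pre_digraph.simps mem_Collect_eq by metis
  with \<open>e = _\<close> show "\<exists>e' \<in> arcs commutativity_graph.
      tail commutativity_graph e = head commutativity_graph e' \<and>
      head commutativity_graph e = tail commutativity_graph e'"
    by (intro bexI[of _ "(vertex_of b, vertex_of a)"])
      (simp add: commutativity_graph_def, assumption)
qed

lemma verts_zd_commutativity_graph:
  "verts zd_commutativity_graph = vertex_of ` zero_divisors"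
  by (simp add: zd_commutativity_graph_def)

lemma zd_commutativity_graph_subgraph:
  "verts zd_commutativity_graph \<subseteq> verts commutativity_graph"
  using zero_divisors_not_scalars by (auto simp: zd_commutativity_graph_def commutativity_graph_def)

lemma wf_zd_commutativity_graph: "wf_digraph zd_commutativity_graph"
  by unfold_locales (auto simp: zd_commutativity_graph_def)

end

theory Submission
  imports Defs
begin

text \<open>
  Read a sedenion $(a,b)$ as the complexified octonion $a + ib$. The zero divisors are then the
  nonzero purely imaginary $x$ with $x^2 = 0$ in $\mathbb{O} \otimes \mathbb{C}$, and two of them
  commute in $\mathbb{S}$ as soon as their product in $\mathbb{O} \otimes \mathbb{C}$ vanishes and their
  Hermitian product is real. Thus, up to phases, one walks in the generalized hexagon of $G_2(\mathbb{C})$,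
  whose diameter is $3$.

  Given $x$ and $y$, a count of linear conditions yields $u$ with $xu = 0$ that is Hermitian
  orthogonal to $x$ and such that $uy$ is purely imaginary. By alternativity, $v = uy$
  satisfies $uv = 0 = vy$ (if $uy = 0$, take $v = y$ instead). The phase of $v$ can be chosen to
  make it commute with $y$, then the phase of $u$ to make it commute with $v$; the vertex $u$
  commutes with $x$ in every phase.

  Conversely, whatever commutes with both $(e_1, e_2)$ and $(e_1, -e_2)$ commutes with $(e_1, 0)$,
  hence has second component $0$ if it is purely imaginary, and so is not a zero divisor.
\<close>

section \<open>Octonion identities\<close>

lemmas cd_defs = zero_cd_def one_cd_def plus_cd_def minus_cd_def uminus_cd_def scaleR_cd_def

text \<open>Eight real coordinates reduce the basic octonion identities to polynomial identities
  over the reals.\<close>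

lemma oct_exhaust:
  fixes x :: octonion
  obtains a b c d e f g h where
    "x = CD (CD (CD a b) (CD c d)) (CD (CD e f) (CD g h))"
  by (metis cd.exhaust)

definition re :: "octonion \<Rightarrow> real" where
  "re x = cd1 (cd1 (cd1 x))"

lemma re_simps [simp]:
  "re (x + y) = re x + re y" "re (x - y) = re x - re y" "re (- x) = - re x"
  "re (r *\<^sub>R x) = r * re x" "re 0 = 0" "re 1 = 1"
  by (simp_all add: re_def cd_defs)

lemma re_invol [simp]: "re (invol x) = re x"
  by (cases x rule: oct_exhaust) (simp add: re_def cd_defs invol_real_def)

lemma oct_add_invol: "x + invol x = (2 * re x) *\<^sub>R (1 :: octonion)"
  by (cases x rule: oct_exhaust) (simp add: re_def cd_defs invol_real_def)

lemma re_mult_commute: "re (x * y) = re (y * x)"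
  by (cases x rule: oct_exhaust; cases y rule: oct_exhaust)
    (simp add: re_def cd_defs invol_real_def algebra_simps)

text \<open>Octonion associators are purely imaginary, so triple products may be rebracketed under
  \<open>re\<close>; this stands in for associativity in the norm and trace computations
  below.\<close>

lemma re_mult_assoc: "re (x * y * z) = re (x * (y * z))"
  by (cases x rule: oct_exhaust; cases y rule: oct_exhaust; cases z rule: oct_exhaust)
    (simp add: re_def cd_defs invol_real_def algebra_simps)

lemma oct_alternative:
  fixes x y :: octonion
  shows oct_left_alternative: "x * (x * y) = x * x * y"
    and oct_right_alternative: "x * y * y = x * (y * y)"
    and oct_flexible: "x * y * x = x * (y * x)"
  by (cases x rule: oct_exhaust; cases y rule: oct_exhaust;
      simp add: cd_defs invol_real_def algebra_simps)+

definition oct_norm :: "octonion \<Rightarrow> real" where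
  "oct_norm x = re (x * invol x)"

lemma oct_mult_invol: "x * invol x = oct_norm x *\<^sub>R 1"
  by (cases x rule: oct_exhaust)
    (simp add: oct_norm_def re_def cd_defs invol_real_def algebra_simps)

lemma oct_norm_nonneg: "0 \<le> oct_norm x"
  and oct_norm_eq_0_iff: "oct_norm x = 0 \<longleftrightarrow> x = 0"
proof -
  obtain a b c d e f g h where x: "x = CD (CD (CD a b) (CD c d)) (CD (CD e f) (CD g h))"
    by (rule oct_exhaust)
  have *: "oct_norm x = a\<^sup>2 + b\<^sup>2 + c\<^sup>2 + d\<^sup>2 + e\<^sup>2 + f\<^sup>2 + g\<^sup>2 + h\<^sup>2"
    by (simp add: x oct_norm_def re_def cd_defs invol_real_def power2_eq_square)
  show "0 \<le> oct_norm x" by (simp add: *)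
  show "oct_norm x = 0 \<longleftrightarrow> x = 0"
    unfolding * by (simp add: x cd_defs add_nonneg_eq_0_iff)
qed

lemma oct_scaleR_one_eq_0_iff: "r *\<^sub>R (1 :: octonion) = 0 \<longleftrightarrow> r = 0"
  by (metis re_simps(4,5,6) mult.right_neutral scaleR_zero_left)

lemma oct_norm_invol: "oct_norm (invol x) = oct_norm x"
  unfolding oct_norm_def by (metis invol_invol re_mult_commute)

lemma oct_norm_minus: "oct_norm (- x) = oct_norm x"
  by (simp add: oct_norm_def ia_simps)

lemma oct_invol_eq: "invol x = (2 * re x) *\<^sub>R 1 - (x :: octonion)"
  using oct_add_invol[of x] by (simp add: eq_diff_eq add.commute)

text \<open>As \<open>invol y\<close> is a real combination of \<open>1\<close> and
  \<open>y\<close>, right alternativity is enough to rebracket.\<close>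

lemma oct_mult_invol_right: "x * y * invol y = oct_norm y *\<^sub>R (x :: octonion)"
proof -
  have "x * y * invol y = x * (y * invol y)"
    unfolding oct_invol_eq by (simp add: ia_simps oct_right_alternative)
  then show ?thesis by (simp add: oct_mult_invol ia_simps)
qed

lemma oct_mult_invol_left: "invol x * (x * y) = oct_norm x *\<^sub>R (y :: octonion)"
proof -
  have "invol (invol x * (x * y)) = oct_norm x *\<^sub>R invol y"
    using oct_mult_invol_right[of "invol y" "invol x"] by (simp add: ia_simps oct_norm_invol)
  then show ?thesis by (metis invol_invol invol_scaleR)
qed

lemma oct_norm_mult: "oct_norm (x * y) = oct_norm x * oct_norm y"
proof -
  have "oct_norm (x * y) = re (x * y * invol y * invol x)"
    by (simp add: oct_norm_def ia_simps re_mult_assoc)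
  then show ?thesis
    by (simp add: oct_mult_invol_right ia_simps oct_norm_def)
qed

lemma oct_invol_imaginary: "re x = 0 \<Longrightarrow> invol x = - x"
  by (simp add: oct_invol_eq)

lemma oct_square_imaginary:
  assumes "re x = 0" shows "x * x = - oct_norm x *\<^sub>R 1"
  using oct_mult_invol[of x] assms by (simp add: oct_invol_imaginary ia_simps) (metis minus_minus)

lemma oct_anticommutator_imaginary:
  assumes "re x = 0" "re y = 0" shows "x * y + y * x = (2 * re (x * y)) *\<^sub>R 1"
  using oct_add_invol[of "x * y"] assms by (simp add: oct_invol_imaginary ia_simps)

text \<open>Polarization of a law quadratic in its first factor. Complexifying left alternativity
  mixes the two parts of that factor, and this sum controls the mixed terms.\<close>

lemma oct_left_alternative_linearized:
  fixes x y z :: octonion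
  shows "x * (y * z) + y * (x * z) = (x * y + y * x) * z"
  using oct_left_alternative[of "x + y" z] oct_left_alternative[of x z] oct_left_alternative[of y z]
  by (simp add: ia_simps algebra_simps)

lemma oct_right_alternative_linearized:
  fixes x y z :: octonion
  shows "z * x * y + z * y * x = z * (x * y + y * x)"
  using oct_right_alternative[of z "x + y"] oct_right_alternative[of z x]
    oct_right_alternative[of z y]
  by (simp add: ia_simps algebra_simps)

section \<open>Zero divisors as isotropic vectors\<close>

lemma cd_eq_zero_iff: "CD a b = 0 \<longleftrightarrow> a = 0 \<and> b = 0"
  by (simp add: zero_cd_def)

lemma cd_sel_zero [simp]: "cd1 0 = 0" "cd2 0 = 0"
  by (simp_all add: zero_cd_def)

text \<open>Pairing the two components of the zero product with \<open>invol c\<close> and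
  \<open>invol d\<close> makes the mixed terms cancel under \<open>re\<close>; what remains is
  \<open>re a\<close> times a positive norm.\<close>

lemma sed_zero_divisor_re:
  assumes "CD a b * CD c d = (0 :: sedenion)" "CD c d \<noteq> 0"
  shows "re a = 0"
proof -
  have eqs: "a * c - invol d * b = 0" "d * a + b * invol c = 0"
    using assms(1) by (simp_all add: cd_eq_zero_iff)
  have "0 = re ((a * c - invol d * b) * invol c) + re (invol d * (d * a + b * invol c))"
    by (simp add: eqs ia_simps)
  also have "\<dots> = (oct_norm c + oct_norm d) * re a"
    by (simp add: ia_simps oct_mult_invol_left oct_mult_invol_right re_mult_assoc algebra_simps)
  finally have "(oct_norm c + oct_norm d) * re a = 0" by simp
  moreover have "oct_norm c + oct_norm d \<noteq> 0"
    using assms(2) oct_norm_nonneg[of c] oct_norm_nonneg[of d]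
    by (auto simp: cd_eq_zero_iff oct_norm_eq_0_iff add_nonneg_eq_0_iff)
  ultimately show ?thesis by simp
qed

text \<open>The product of $\mathbb{O} \otimes \mathbb{C}$, with $(a,b)$ standing for $a + ib$.\<close>

definition cmult :: "sedenion \<Rightarrow> sedenion \<Rightarrow> sedenion" (infixl "\<odot>" 70) where
  "x \<odot> y = CD (cd1 x * cd1 y - cd2 x * cd2 y) (cd1 x * cd2 y + cd2 x * cd1 y)"

definition pure :: "sedenion \<Rightarrow> bool" where
  "pure x \<longleftrightarrow> re (cd1 x) = 0 \<and> re (cd2 x) = 0"

definition isotropic :: "sedenion \<Rightarrow> bool" where
  "isotropic x \<longleftrightarrow> x \<noteq> 0 \<and> pure x \<and> x \<odot> x = 0"

lemma cmult_CD: "CD a b \<odot> CD c d = CD (a * c - b * d) (a * d + b * c)"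
  by (simp add: cmult_def)

lemma isotropic_if_left_zero_divisor:
  assumes zero: "x * w = 0" and "x \<noteq> 0" "w \<noteq> (0 :: sedenion)"
  shows "isotropic x"
proof -
  obtain a b c d where x: "x = CD a b" and w: "w = CD c d"
    by (metis cd.exhaust)
  have eqs: "a * c = invol d * b" "d * a = - (b * invol c)"
    using zero by (simp_all add: x w cd_eq_zero_iff eq_neg_iff_add_eq_0)
  have w0: "CD c d \<noteq> 0" using assms by (simp add: w)
  have a0: "re a = 0" using sed_zero_divisor_re zero w0 by (simp only: x w)
  txt \<open>Right multiplication by $(0,1)$ maps $(a,b)$ to $(-b,a)$ and preserves zero divisors.\<close>
  have "CD (- b) a * CD (invol c) (invol d) = 0"
    using eqs by (simp add: cd_eq_zero_iff ia_simps)
  moreover have "CD (invol c) (invol d) \<noteq> 0"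
    using w0 by (metis cd_eq_zero_iff invol_invol invol_zero)
  ultimately have b0: "re b = 0" using sed_zero_divisor_re by fastforce
  have norms: "oct_norm a * oct_norm c = oct_norm d * oct_norm b"
    "oct_norm d * oct_norm a = oct_norm b * oct_norm c"
    using arg_cong[OF eqs(1), of oct_norm] arg_cong[OF eqs(2), of oct_norm]
    by (simp_all add: oct_norm_mult oct_norm_invol oct_norm_minus)
  then have "(oct_norm c + oct_norm d) * (oct_norm a - oct_norm b) = 0"
    by (simp add: algebra_simps)
  moreover have cd: "oct_norm c + oct_norm d \<noteq> 0"
    using w0 oct_norm_nonneg[of c] oct_norm_nonneg[of d]
    by (auto simp: cd_eq_zero_iff oct_norm_eq_0_iff add_nonneg_eq_0_iff)
  ultimately have ab: "oct_norm a = oct_norm b" by simp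
  \<comment> \<open>Rewriting one real part through both equations of \<open>eqs\<close> turns the
    factor \<open>- oct_norm c\<close> of \<open>re (a * b)\<close> into \<open>oct_norm d\<close>.
    As the norms have positive sum, \<open>re (a * b)\<close> vanishes.\<close>
  have "- (oct_norm c * re (a * b)) = re (a * c * invol (b * c))"
    using b0 by (simp add: ia_simps oct_invol_imaginary re_mult_assoc[symmetric]
        oct_mult_invol_right)
  also have "\<dots> = - re (invol d * b * (invol c * b))"
    using b0 by (simp add: eqs ia_simps oct_invol_imaginary)
  also have "re (invol d * b * (invol c * b)) = re (invol (invol d * b * (invol c * b)))"
    by simp
  also have "\<dots> = re (b * c * (b * d))"
    using b0 by (simp add: ia_simps oct_invol_imaginary)
  also have "\<dots> = re (c * (b * d) * b)"
    by (metis re_mult_assoc re_mult_commute)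
  also have "\<dots> = re (c * (b * (d * b)))"
    by (simp add: re_mult_assoc oct_flexible)
  also have "\<dots> = re (c * b * (d * b))"
    by (simp add: re_mult_assoc)
  also have "\<dots> = re (invol (d * a) * (d * b))"
    using b0 by (simp add: eqs ia_simps oct_invol_imaginary)
  also have "\<dots> = - (oct_norm d * re (a * b))"
    using a0 by (simp add: ia_simps oct_invol_imaginary re_mult_assoc
        oct_mult_invol_left)
  finally have 1: "oct_norm c * re (a * b) = - (oct_norm d * re (a * b))" by simp
  then have "(oct_norm c + oct_norm d) * re (a * b) = 0"
    by (simp add: algebra_simps)
  with cd have "re (a * b) = 0" by simp
  then have "a * b + b * a = 0"
    using oct_anticommutator_imaginary[OF a0 b0] by simp
  then show ?thesis
    using assms(2) a0 b0 ab
    by (simp add: isotropic_def pure_def x cmult_CD oct_square_imaginary cd_eq_zero_iff)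
qed

lemma isotropic_if_zero_divisor:
  assumes "x \<in> zero_divisors"
  shows "isotropic x"
proof -
  obtain w where w: "x \<noteq> 0" "w \<noteq> 0" "x * w = 0 \<or> w * x = 0"
    using assms by (auto simp: zero_divisors_def)
  show ?thesis
  proof (cases "x * w = 0")
    case True
    then show ?thesis using w isotropic_if_left_zero_divisor by blast
  next
    case False
    have inv0: "invol z = 0 \<Longrightarrow> z = 0" for z :: sedenion
      by (metis invol_invol invol_zero)
    \<comment> \<open>Conjugation swaps the factors, making a right zero divisor a left one. On pure
      sedenions it is negation, so isotropy transfers back to \<open>x\<close>.\<close>
    have "invol x * invol w = invol (w * x)" by (simp add: invol_mult)
    also have "\<dots> = 0" using w False by (simp add: invol_zero)
    finally have "isotropic (invol x)"
      using isotropic_if_left_zero_divisor w inv0 by blast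
    moreover obtain a b where "x = CD a b" by (metis cd.exhaust)
    ultimately show ?thesis
      by (auto simp: isotropic_def pure_def cmult_CD cd_eq_zero_iff ia_simps oct_invol_imaginary)
  qed
qed

text \<open>Multiplication by the complex number $r + is$.\<close>

definition cscale :: "real \<Rightarrow> real \<Rightarrow> sedenion \<Rightarrow> sedenion" where
  "cscale r s x = CD (r *\<^sub>R cd1 x - s *\<^sub>R cd2 x) (r *\<^sub>R cd2 x + s *\<^sub>R cd1 x)"

lemma cscale_CD: "cscale r s (CD a b) = CD (r *\<^sub>R a - s *\<^sub>R b) (r *\<^sub>R b + s *\<^sub>R a)"
  by (simp add: cscale_def)

lemma cscale_eq_0D:
  assumes "cscale r s x = 0" "r \<noteq> 0 \<or> s \<noteq> 0"
  shows "x = 0"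
proof -
  obtain a b where x: "x = CD a b" by (metis cd.exhaust)
  have *: "r *\<^sub>R a - s *\<^sub>R b = 0" "r *\<^sub>R b + s *\<^sub>R a = 0"
    using assms(1) by (simp_all add: x cscale_CD cd_eq_zero_iff)
  \<comment> \<open>Both right-hand sides are the components of \<open>cscale r s x\<close>
    multiplied by the conjugate scalar r - is.\<close>
  have "(r\<^sup>2 + s\<^sup>2) *\<^sub>R a = r *\<^sub>R (r *\<^sub>R a - s *\<^sub>R b) + s *\<^sub>R (r *\<^sub>R b + s *\<^sub>R a)"
    "(r\<^sup>2 + s\<^sup>2) *\<^sub>R b = r *\<^sub>R (r *\<^sub>R b + s *\<^sub>R a) - s *\<^sub>R (r *\<^sub>R a - s *\<^sub>R b)"
    by (simp_all add: algebra_simps power2_eq_square)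
  then have "(r\<^sup>2 + s\<^sup>2) *\<^sub>R a = 0" "(r\<^sup>2 + s\<^sup>2) *\<^sub>R b = 0"
    by (simp_all add: *)
  moreover have "r\<^sup>2 + s\<^sup>2 \<noteq> 0" using assms(2) by (simp add: sum_power2_eq_zero_iff)
  ultimately show ?thesis by (simp add: x cd_eq_zero_iff del: sum_power2_eq_zero_iff)
qed

lemma cmult_cscale_left: "cscale r s x \<odot> y = cscale r s (x \<odot> y)"
  and cmult_cscale_right: "x \<odot> cscale r s y = cscale r s (x \<odot> y)"
  by (cases x; cases y; simp add: cscale_CD cmult_CD ia_simps algebra_simps)+

lemma cscale_0: "cscale r s 0 = 0"
  by (simp add: cscale_def cd_eq_zero_iff)

lemma pure_cscale: "pure x \<Longrightarrow> pure (cscale r s x)"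
  by (simp add: pure_def cscale_def)

lemma isotropic_cscale:
  "isotropic x \<Longrightarrow> r \<noteq> 0 \<or> s \<noteq> 0 \<Longrightarrow> isotropic (cscale r s x)"
  using cscale_eq_0D
  by (auto simp: isotropic_def pure_cscale cmult_cscale_left cmult_cscale_right cscale_0)

section \<open>Alternativity and isotropy in the complexified octonions\<close>

lemma cmult_left_alternative: "x \<odot> (x \<odot> y) = x \<odot> x \<odot> y"
proof -
  obtain a b c d where xy: "x = CD a b" "y = CD c d" by (metis cd.exhaust)
  show ?thesis
    using oct_left_alternative_linearized[of a b c] oct_left_alternative_linearized[of a b d]
    by (simp add: xy cmult_CD ia_simps oct_left_alternative algebra_simps)
qed

lemma cmult_right_alternative: "x \<odot> y \<odot> y = x \<odot> (y \<odot> y)"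
proof -
  obtain a b c d where xy: "x = CD a b" "y = CD c d" by (metis cd.exhaust)
  show ?thesis
    using oct_right_alternative_linearized[of a c d] oct_right_alternative_linearized[of b c d]
    by (simp add: xy cmult_CD ia_simps oct_right_alternative algebra_simps)
qed

lemma cmult_0_left: "0 \<odot> x = 0" and cmult_0_right: "x \<odot> 0 = 0"
  by (simp_all add: cmult_def cd_eq_zero_iff ia_simps)

text \<open>Conjugating both octonion components reverses the product; on pure factors it only
  changes two signs, which cancel.\<close>

lemma cmult_eq_0_commute:
  assumes "pure x" "pure y" "x \<odot> y = 0"
  shows "y \<odot> x = 0"
proof -
  obtain a b c d where xy: "x = CD a b" "y = CD c d" by (metis cd.exhaust)
  have "invol (cd1 (x \<odot> y)) = cd1 (y \<odot> x)" "invol (cd2 (x \<odot> y)) = cd2 (y \<odot> x)"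
    using assms(1,2) by (simp_all add: xy pure_def cmult_CD ia_simps oct_invol_imaginary)
  then show ?thesis using assms(3)
    by (metis cd.collapse cd.sel invol_zero zero_cd_def)
qed

text \<open>The square of a pure element is a complex scalar r + is. By alternativity this scalar
  annihilates \<open>y\<close>, so it is zero.\<close>

lemma isotropic_if_cmult_eq_0:
  assumes "pure x" "x \<noteq> 0" "x \<odot> y = 0" "y \<noteq> 0"
  shows "isotropic x"
proof -
  obtain a b where x: "x = CD a b" by (metis cd.exhaust)
  have ab: "re a = 0" "re b = 0" using assms(1) by (simp_all add: x pure_def)
  define r s where "r = oct_norm b - oct_norm a" and "s = 2 * re (a * b)"
  have sq: "x \<odot> x = CD (r *\<^sub>R 1) (s *\<^sub>R 1)"
    using oct_anticommutator_imaginary[OF ab]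
    by (simp add: x cmult_CD oct_square_imaginary ab r_def s_def scaleR_diff_left)
  have "cscale r s y = x \<odot> x \<odot> y"
    unfolding sq by (cases y) (simp add: cmult_CD cscale_CD ia_simps)
  also have "\<dots> = 0"
    by (simp add: cmult_left_alternative[symmetric] assms cmult_0_right)
  finally have "r = 0 \<and> s = 0" using cscale_eq_0D assms(4) by blast
  then show ?thesis using assms sq by (simp add: isotropic_def zero_cd_def)
qed

section \<open>Sedenion commutation from complexified products\<close>

text \<open>For pure (a,b) and (c,d), commuting means ac + db = ca + bd and da = bc. Conjugating ac
  = bd gives the first. The second is ad = -bc, because da = -ad when ad is purely imaginary; this
  last condition says that the Hermitian product is real.\<close>

lemma commute_if_cmult_eq_0:
  assumes "pure x" "pure y" "x \<odot> y = 0" "re (cd1 x * cd2 y) = 0"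
  shows "x * y = y * x"
proof -
  obtain a b c d where xy: "x = CD a b" "y = CD c d" by (metis cd.exhaust)
  have im: "re a = 0" "re b = 0" "re c = 0" "re d = 0" and ad: "re (a * d) = 0"
    using assms by (simp_all add: xy pure_def)
  have 1: "a * c = b * d" and 2: "a * d = - (b * c)"
    using assms(3) by (simp_all add: xy cmult_CD cd_eq_zero_iff eq_neg_iff_add_eq_0)
  have 3: "c * a = d * b"
    using arg_cong[OF 1, of invol] by (simp add: ia_simps oct_invol_imaginary im)
  have 4: "d * a = b * c"
  proof -
    have "d * a = invol (a * d)" by (simp add: ia_simps oct_invol_imaginary im)
    then show ?thesis unfolding oct_invol_imaginary[OF ad] by (simp add: 2)
  qed
  show ?thesis
    by (simp add: xy oct_invol_imaginary im ia_simps 1 3 4)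
qed

text \<open>A complex factor r + is keeps the product zero, and the remaining condition is one real
  linear equation in \<open>r\<close> and \<open>s\<close>, solved by \<open>p\<close> and
  \<open>- q\<close>.\<close>

lemma commute_after_cscale:
  assumes "pure x" "pure y" "x \<odot> y = 0"
  obtains r s where "r \<noteq> 0 \<or> s \<noteq> 0" "x * cscale r s y = cscale r s y * x"
proof -
  define p q where "p = re (cd1 x * cd1 y)" and "q = re (cd1 x * cd2 y)"
  obtain r s where rs: "r \<noteq> 0 \<or> s \<noteq> 0" "r * q + s * p = 0"
  proof (cases "p = 0 \<and> q = 0")
    case True
    then show ?thesis using that[of 1 0] by simp
  next
    case False
    then show ?thesis using that[of p "- q"] by auto
  qed
  then have "re (cd1 x * cd2 (cscale r s y)) = 0"
    by (simp add: cscale_def ia_simps p_def q_def)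
  then show thesis
    using that rs(1) commute_if_cmult_eq_0[of x "cscale r s y"] assms
    by (simp add: pure_cscale cmult_cscale_right cscale_0)
qed

section \<open>Isotropic annihilators by a dimension count\<close>

definition oct_of_vec :: "real ^ 8 \<Rightarrow> octonion" where
  "oct_of_vec v = CD (CD (CD (v $ 1) (v $ 2)) (CD (v $ 3) (v $ 4)))
    (CD (CD (v $ 5) (v $ 6)) (CD (v $ 7) (v $ 8)))"

lemma exhaust_8:
  fixes i :: 8
  shows "i = 1 \<or> i = 2 \<or> i = 3 \<or> i = 4 \<or> i = 5 \<or> i = 6 \<or> i = 7 \<or> i = 8"
proof (induct i)
  case (of_int z)
  \<comment> \<open>In the type \<open>8\<close> the numeral 8 equals 0, so \<open>z = 0\<close> is
    the last case.\<close>
  then have "z = 0 \<or> z = 1 \<or> z = 2 \<or> z = 3 \<or> z = 4 \<or> z = 5 \<or> z = 6 \<or> z = 7" by simp arith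
  then show ?case by auto
qed

lemma linear_oct_of_vec: "linear oct_of_vec"
  by (rule linearI) (simp_all add: oct_of_vec_def cd_defs)

lemma oct_of_vec_eq_0D: "oct_of_vec v = 0 \<Longrightarrow> v = 0"
  unfolding oct_of_vec_def cd_eq_zero_iff vec_eq_iff by (metis exhaust_8 zero_index)

text \<open>Six real functionals on a space of dimension eight; the dimension is transported along
  the injection \<open>oct_of_vec\<close>.\<close>

lemma exists_common_zero_6_functionals:
  fixes f :: "octonion \<Rightarrow> real ^ 6"
  assumes "linear f"
  obtains c where "c \<noteq> 0" "f c = 0"
proof -
  have lin: "linear (f \<circ> oct_of_vec)"
    using linear_compose linear_oct_of_vec assms by blast
  have "\<not> inj (f \<circ> oct_of_vec)"
  proof
    assume "inj (f \<circ> oct_of_vec)"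
    then have "dim (range (f \<circ> oct_of_vec)) = DIM(real ^ 8)"
      using dim_image_eq[OF lin, of UNIV] by (simp add: span_UNIV)
    moreover have "dim (range (f \<circ> oct_of_vec)) \<le> DIM(real ^ 6)"
      by (rule dim_subset_UNIV)
    ultimately show False by simp
  qed
  then obtain v where "v \<noteq> 0" "f (oct_of_vec v) = 0"
    using linear_injective_0[OF lin] by auto
  then show thesis using that oct_of_vec_eq_0D by blast
qed


text \<open>
  The last two conditions make $x$ and $u$ Hermitian orthogonal: together with the vanishing of the
  scalar part of $xu$ they kill both parts of the Hermitian product.
\<close>

lemma exists_isotropic_annihilator:
  assumes "isotropic x" and y: "pure y"
  obtains u where "isotropic u" "x \<odot> u = 0" "pure (u \<odot> y)"
    "re (cd1 x * cd1 u) = 0" "re (cd1 x * cd2 u) = 0"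
proof -
  obtain a b where x: "x = CD a b" by (metis cd.exhaust)
  have ab: "re a = 0" "re b = 0" using assms(1) by (simp_all add: x isotropic_def pure_def)
  define n where "n = oct_norm a"
  have sq: "a * a = - n *\<^sub>R 1" "b * b = - n *\<^sub>R 1" and anti: "a * b + b * a = 0"
    using assms(1) oct_square_imaginary[OF ab(1)]
    by (simp_all add: x isotropic_def cmult_CD cd_eq_zero_iff n_def)
  have n0: "n \<noteq> 0"
  proof
    assume "n = 0"
    then have "a = 0" by (simp add: n_def oct_norm_eq_0_iff)
    moreover have "oct_norm b *\<^sub>R (1 :: octonion) = 0"
      using sq(2) oct_square_imaginary[OF ab(2)] \<open>n = 0\<close> by simp
    then have "b = 0" by (simp only: oct_scaleR_one_eq_0_iff oct_norm_eq_0_iff)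
    ultimately show False using assms(1) by (simp add: x isotropic_def cd_eq_zero_iff)
  qed
  \<comment> \<open>\<open>U c\<close> is the product of \<open>x\<close> with
    \<open>CD (- (a * c)) 0\<close>, so alternativity and \<open>x \<odot> x = 0\<close> explain why
    \<open>x\<close> annihilates it. Its first component makes \<open>U\<close> injective.\<close>
  define U where "U c = CD (n *\<^sub>R c) (a * (b * c))" for c
  have U0: "x \<odot> U c = 0" for c
  proof -
    have aa: "a * (a * z) = - n *\<^sub>R z" and bb: "b * (b * z) = - n *\<^sub>R z" for z
      by (simp_all add: oct_left_alternative sq ia_simps)
    have "b * (a * z) = - (a * (b * z))" for z
      using oct_left_alternative_linearized[of a b z] anti
      by (simp add: ia_zero_left eq_neg_iff_add_eq_0 add.commute)
    then show ?thesis
      by (simp add: x U_def cmult_CD cd_eq_zero_iff ia_simps aa bb)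
  qed
  \<comment> \<open>Two conditions each for purity of \<open>U c\<close>, purity of
    \<open>U c \<odot> y\<close> and Hermitian orthogonality to \<open>x\<close>.\<close>
  define f :: "octonion \<Rightarrow> real ^ 6" where
    "f c = (\<chi> i. if i = 1 then re (cd1 (U c)) else if i = 2 then re (cd2 (U c))
      else if i = 3 then re (cd1 (U c \<odot> y)) else if i = 4 then re (cd2 (U c \<odot> y))
      else if i = 5 then re (a * cd1 (U c)) else re (a * cd2 (U c)))" for c
  have "linear f"
    by (rule linearI) (simp_all add: f_def vec_eq_iff U_def cmult_def ia_simps algebra_simps)
  then obtain c where "c \<noteq> 0" and c: "f c = 0"
    using exists_common_zero_6_functionals by blast
  have "f c $ i = 0" for i by (simp add: c)
  from this[of 1] this[of 2] this[of 3] this[of 4] this[of 5] this[of 6]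
  have fc: "re (cd1 (U c)) = 0" "re (cd2 (U c)) = 0"
    "re (cd1 (U c \<odot> y)) = 0" "re (cd2 (U c \<odot> y)) = 0"
    "re (a * cd1 (U c)) = 0" "re (a * cd2 (U c)) = 0"
    by (simp_all add: f_def)
  then have pU: "pure (U c)" "pure (U c \<odot> y)" by (simp_all add: pure_def)
  have "U c \<noteq> 0" using n0 \<open>c \<noteq> 0\<close> by (simp add: U_def cd_eq_zero_iff)
  moreover have "pure x" "x \<noteq> 0" using assms(1) by (simp_all add: isotropic_def)
  ultimately have "isotropic (U c)"
    using isotropic_if_cmult_eq_0[OF pU(1), of x] cmult_eq_0_commute[OF _ pU(1) U0] by blast
  then show thesis using that[of "U c"] U0 pU fc x by simp
qed

text \<open>With ac and ad purely imaginary, conjugation gives db = -ac and da = -ad = bc, so both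
  components ac + db and da - bc of the sedenion product cancel.\<close>

lemma mult_eq_0_if_cmult_eq_0:
  assumes "pure x" "pure u" "x \<odot> u = 0" "re (cd1 x * cd1 u) = 0" "re (cd1 x * cd2 u) = 0"
  shows "x * u = 0"
proof -
  obtain a b c d where xu: "x = CD a b" "u = CD c d" by (metis cd.exhaust)
  have im: "re a = 0" "re b = 0" "re c = 0" "re d = 0"
    and ac: "re (a * c) = 0" and ad: "re (a * d) = 0"
    using assms by (simp_all add: xu pure_def)
  have 1: "b * d = a * c" and 2: "b * c = - (a * d)"
    using assms(3) by (simp_all add: xu cmult_CD cd_eq_zero_iff eq_neg_iff_add_eq_0 add.commute)
  have "d * b = invol (b * d)" by (simp add: ia_simps oct_invol_imaginary im)
  then have 3: "d * b = - (a * c)" by (simp add: 1 oct_invol_imaginary ac)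
  have "d * a = invol (a * d)" by (simp add: ia_simps oct_invol_imaginary im)
  then have 4: "d * a = - (a * d)" by (simp add: oct_invol_imaginary ad)
  show ?thesis
    by (simp add: xu cd_eq_zero_iff oct_invol_imaginary im ia_simps 2 3 4)
qed

text \<open>For the converse inclusion, an annihilator Hermitian orthogonal to \<open>x\<close> in
  the complexified product is also a sedenion annihilator.\<close>

lemma zero_divisors_sedenion: "zero_divisors = {x. isotropic x}"
proof (intro equalityI subsetI CollectI)
  fix x :: sedenion assume "x \<in> {x. isotropic x}"
  then have x: "isotropic x" by simp
  then obtain u where "isotropic u" "x \<odot> u = 0"
    "re (cd1 x * cd1 u) = 0" "re (cd1 x * cd2 u) = 0"
    using exists_isotropic_annihilator[OF x, of x] by (auto simp: isotropic_def)
  with x have "x * u = 0" "u \<noteq> 0" "x \<noteq> 0"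
    by (auto simp: isotropic_def intro: mult_eq_0_if_cmult_eq_0)
  then show "x \<in> zero_divisors" by (auto simp: zero_divisors_def)
qed (rule isotropic_if_zero_divisor)

lemma commuting_path:
  assumes x: "isotropic x" and y: "isotropic y"
  obtains u v where "isotropic u" "isotropic v" "x * u = u * x" "u * v = v * u" "v * y = y * v"
proof -
  have px: "pure x" and py: "pure y" using x y by (simp_all add: isotropic_def)
  obtain u where u: "isotropic u" and xu: "x \<odot> u = 0" and uy: "pure (u \<odot> y)"
    and xu_re: "re (cd1 x * cd1 u) = 0" "re (cd1 x * cd2 u) = 0"
    using exists_isotropic_annihilator[OF x py] .
  have pu: "pure u" using u by (simp add: isotropic_def)
  \<comment> \<open>Orthogonality survives every phase, so the phase of \<open>u\<close> stays free
    until \<open>v\<close> has been chosen.\<close>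
  have x_comm: "x * cscale r s u = cscale r s u * x" for r s
  proof (rule commute_if_cmult_eq_0[OF px pure_cscale[OF pu]])
    show "x \<odot> cscale r s u = 0" by (simp add: cmult_cscale_right cscale_0 xu)
    show "re (cd1 x * cd2 (cscale r s u)) = 0" by (simp add: cscale_def ia_simps xu_re)
  qed
  obtain v where v: "isotropic v" and uv: "u \<odot> v = 0" and vy: "v * y = y * v"
  proof (cases "u \<odot> y = 0")
    case True
    then show thesis using that[of y] y by simp
  next
    case False
    have 0: "u \<odot> y \<odot> y = 0"
      using y by (simp add: cmult_right_alternative isotropic_def cmult_0_right)
    have "isotropic (u \<odot> y)"
      using isotropic_if_cmult_eq_0[OF uy False 0] y by (simp add: isotropic_def)
    moreover have "u \<odot> (u \<odot> y) = 0"
      using u by (simp add: cmult_left_alternative isotropic_def cmult_0_left)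
    moreover obtain r s where "r \<noteq> 0 \<or> s \<noteq> 0"
      "y * cscale r s (u \<odot> y) = cscale r s (u \<odot> y) * y"
      using commute_after_cscale[OF py uy cmult_eq_0_commute[OF uy py 0]] .
    ultimately show thesis
      using that[of "cscale r s (u \<odot> y)"] isotropic_cscale
      by (simp add: cmult_cscale_right cscale_0)
  qed
  have pv: "pure v" using v by (simp add: isotropic_def)
  obtain r s where "r \<noteq> 0 \<or> s \<noteq> 0" "v * cscale r s u = cscale r s u * v"
    using commute_after_cscale[OF pv pu cmult_eq_0_commute[OF pu pv uv]] .
  then show thesis
    using that[of "cscale r s u" v] u v vy x_comm isotropic_cscale by simp
qed

section \<open>The diameter\<close>

abbreviation dist_zd :: "'a::involutive_algebra set \<Rightarrow> 'a set \<Rightarrow> ereal" where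
  "dist_zd \<equiv> wf_digraph.\<mu> zd_commutativity_graph (\<lambda>_. 1)"

section \<open>Walks and commuting zero divisors\<close>

lemma arcs_zd_commutativity_graph:
  fixes a b :: "'a::involutive_algebra"
  assumes "a \<in> zero_divisors" "b \<in> zero_divisors"
    "vertex_of a \<noteq> vertex_of b" "a * b = b * a"
  shows "(vertex_of a, vertex_of b) \<in> arcs zd_commutativity_graph"
proof -
  have "a \<notin> scalars" "b \<notin> scalars" using assms(1,2) zero_divisors_not_scalars by auto
  then show ?thesis
    using assms by (auto simp: zd_commutativity_graph_def commutativity_graph_def)
qed

lemma (in wf_digraph) awalk_cost_1: "awalk_cost (\<lambda>_. 1) p = real (length p)"
  by (induction p) simp_all

text \<open>The graph has no loops: commuting elements of the same vertex are joined by the empty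
  walk, hence a bound instead of an exact length.\<close>

lemma short_awalk_if_commute:
  fixes a b :: "'a::involutive_algebra"
  assumes "a \<in> zero_divisors" "b \<in> zero_divisors" "a * b = b * a"
  obtains p where "pre_digraph.awalk zd_commutativity_graph (vertex_of a) p (vertex_of b)"
    "length p \<le> 1"
proof -
  interpret wf_digraph "zd_commutativity_graph :: 'a subspace_graph"
    by (rule wf_zd_commutativity_graph)
  show thesis
  proof (cases "vertex_of a = vertex_of b")
    case True
    then show thesis
      using that[of "[]"] assms(2) by (simp add: awalk_Nil_iff verts_zd_commutativity_graph)
  next
    case False
    then show thesis
      using that[of "[(vertex_of a, vertex_of b)]"]
        arc_implies_awalk[OF arcs_zd_commutativity_graph[OF assms(1,2) False assms(3)]]
      by (simp add: zd_commutativity_graph_def commutativity_graph_def)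
  qed
qed

lemma commute_if_arc:
  fixes a :: "'a::involutive_algebra"
  assumes "e \<in> arcs zd_commutativity_graph" "tail zd_commutativity_graph e = vertex_of a"
  obtains b where "b \<in> zero_divisors" "head zd_commutativity_graph e = vertex_of b"
    "a * b = b * a"
proof -
  have "\<exists>a' b' :: 'a. fst e = vertex_of a' \<and> snd e = vertex_of b' \<and> a' * b' = b' * a'"
    using assms(1) by (fastforce simp: zd_commutativity_graph_def commutativity_graph_def)
  then obtain a' b' where "fst e = vertex_of a'" "snd e = vertex_of b'" "a' * b' = b' * a'"
    by blast
  moreover have "snd e \<in> vertex_of ` zero_divisors"
    using assms(1) by (simp add: zd_commutativity_graph_def commutativity_graph_def)
  moreover from this obtain b where "b \<in> zero_divisors" "snd e = vertex_of b" by blast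
  moreover have "fst e = vertex_of a" "head zd_commutativity_graph e = snd e"
    using assms(2) by (simp_all add: zd_commutativity_graph_def commutativity_graph_def)
  ultimately show thesis
    using that commute_if_same_vertices[of a' a b' b] by metis
qed

text \<open>Shorter walks fit in because elements of the same vertex commute; for the empty walk
  \<open>x\<close> itself serves as \<open>w\<close>.\<close>

lemma common_neighbour_if_awalk:
  fixes x y :: "'a::involutive_algebra"
  assumes walk: "pre_digraph.awalk zd_commutativity_graph (vertex_of x) p (vertex_of y)"
    and "length p \<le> 2" and x: "x \<in> zero_divisors"
  obtains w where "w \<in> zero_divisors" "x * w = w * x" "w * y = y * w"
proof -
  interpret wf_digraph "zd_commutativity_graph :: 'a subspace_graph"
    by (rule wf_zd_commutativity_graph)
  have last_step: "w * y = y * w"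
    if "awalk (vertex_of w) q (vertex_of y)" "length q \<le> 1" for w q
  proof (cases q)
    case Nil
    then have "vertex_of w = vertex_of y" using that by (simp add: awalk_Nil_iff)
    then show ?thesis using commute_if_same_vertices[of w w w y] by simp
  next
    case (Cons e q')
    with that have e: "e \<in> arcs zd_commutativity_graph"
      "tail zd_commutativity_graph e = vertex_of w" "head zd_commutativity_graph e = vertex_of y"
      by (auto simp: awalk_Cons_iff awalk_Nil_iff)
    obtain b where "head zd_commutativity_graph e = vertex_of b" "w * b = b * w"
      using commute_if_arc[OF e(1,2)] .
    then show ?thesis using e(3) commute_if_same_vertices[of w w b y] by simp
  qed
  show thesis
  proof (cases p)
    case Nil
    then show thesis using that[OF x] last_step walk by simp
  next
    case (Cons e q)
    then have e: "e \<in> arcs zd_commutativity_graph" "tail zd_commutativity_graph e = vertex_of x"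
      and q: "awalk (head zd_commutativity_graph e) q (vertex_of y)" "length q \<le> 1"
      using walk \<open>length p \<le> 2\<close> by (auto simp: awalk_Cons_iff)
    obtain w where "w \<in> zero_divisors" "head zd_commutativity_graph e = vertex_of w"
      "x * w = w * x"
      using commute_if_arc[OF e] .
    then show thesis using that q last_step by simp
  qed
qed

section \<open>Upper and lower bounds for the distance\<close>

lemma dist_zd_sedenion_le_3:
  assumes "x \<in> zero_divisors" "y \<in> (zero_divisors :: sedenion set)"
  shows "dist_zd (vertex_of x) (vertex_of y) \<le> 3"
proof -
  interpret wf_digraph "zd_commutativity_graph :: sedenion subspace_graph"
    by (rule wf_zd_commutativity_graph)
  obtain u v where uv: "u \<in> zero_divisors" "v \<in> zero_divisors"
    "x * u = u * x" "u * v = v * u" "v * y = y * v"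
    using commuting_path assms unfolding zero_divisors_sedenion mem_Collect_eq by metis
  obtain p q r where p: "awalk (vertex_of x) p (vertex_of u)" "length p \<le> 1"
    and q: "awalk (vertex_of u) q (vertex_of v)" "length q \<le> 1"
    and r: "awalk (vertex_of v) r (vertex_of y)" "length r \<le> 1"
    using short_awalk_if_commute uv assms by metis
  have "awalk (vertex_of x) (p @ q @ r) (vertex_of y)"
    using p q r by (blast intro: awalk_appendI)
  then have "dist_zd (vertex_of x) (vertex_of y) \<le> ereal (awalk_cost (\<lambda>_. 1) (p @ q @ r))"
    by (rule min_cost_le_walk_cost)
  also have "\<dots> \<le> ereal 3"
    using p q r by (simp add: awalk_cost_1)
  finally show ?thesis by simp
qed

lemma dist_zd_sedenion_ge_3:
  obtains x y :: sedenion where "x \<in> zero_divisors" "y \<in> zero_divisors"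
    "3 \<le> dist_zd (vertex_of x) (vertex_of y)"
proof -
  interpret wf_digraph "zd_commutativity_graph :: sedenion subspace_graph"
    by (rule wf_zd_commutativity_graph)
  \<comment> \<open>Two anticommuting imaginary units: they have equal norm and are orthogonal, so
    both i + ij and i - ij in the complexified sense are isotropic, where the middle product is by
    the complex unit.\<close>
  define i j :: octonion where "i = CD (CD (CD 0 1) 0) 0" and "j = CD (CD 0 (CD 1 0)) 0"
  define x y where "x = CD i j" and "y = CD i (- j)"
  have ij: "re i = 0" "re j = 0" "i * i = -1" "j * j = -1" "i * j = - (j * i)"
    by (simp_all add: i_def j_def re_def cd_defs invol_real_def)
  have "i \<noteq> 0" by (simp add: i_def zero_cd_def)
  then have xy: "x \<in> zero_divisors" "y \<in> zero_divisors"
    by (simp_all add: zero_divisors_sedenion x_def y_def isotropic_def pure_def cmult_CD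
        cd_eq_zero_iff ia_simps ij)
  have no_common: False
    if "w \<in> zero_divisors" "x * w = w * x" "w * y = y * w" for w
  proof -
    obtain g k where w: "w = CD g k" by (metis cd.exhaust)
    have iso: "isotropic w" using that(1) by (simp add: zero_divisors_sedenion)
    then have gk: "re g = 0" "re k = 0" by (simp_all add: w isotropic_def pure_def)
    have xy_sum: "x + y = CD (2 *\<^sub>R i) 0"
      by (simp add: x_def y_def plus_cd_def[where 'a = octonion] scaleR_2[symmetric])
    have "(x + y) * w = w * (x + y)" using that(2,3) by (simp add: ia_simps)
    \<comment> \<open>Second components: multiplying by \<open>CD (2 *\<^sub>R i) 0\<close> from the
      right conjugates the imaginary \<open>i\<close>, which flips the sign.\<close>
    then have "2 *\<^sub>R (k * i) = - (2 *\<^sub>R (k * i))"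
      by (simp add: xy_sum w ia_simps oct_invol_imaginary ij)
    then have "2 *\<^sub>R (k * i) + 2 *\<^sub>R (k * i) = 0"
      by (simp only: eq_neg_iff_add_eq_0)
    then have "k * i = 0" by (simp add: scaleR_left_distrib[symmetric])
    then have "oct_norm k * oct_norm i = 0"
      by (simp add: oct_norm_mult[symmetric] oct_norm_eq_0_iff)
    then have "k = 0" using \<open>i \<noteq> 0\<close> by (simp add: oct_norm_eq_0_iff)
    \<comment> \<open>With \<open>k = 0\<close>, isotropy reduces to \<open>g * g = 0\<close>, and
      the square of an imaginary octonion is minus its norm.\<close>
    then have "oct_norm g *\<^sub>R (1 :: octonion) = 0"
      using iso by (simp add: w isotropic_def cmult_CD cd_eq_zero_iff ia_simps
          oct_square_imaginary gk)
    then have "g = 0" by (simp only: oct_scaleR_one_eq_0_iff oct_norm_eq_0_iff)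
    then show False using iso \<open>k = 0\<close> by (simp add: w isotropic_def cd_eq_zero_iff)
  qed
  have "3 \<le> dist_zd (vertex_of x) (vertex_of y)"
    unfolding \<mu>_def
  proof (rule INF_greatest)
    fix p assume "p \<in> {p. awalk (vertex_of x) p (vertex_of y)}"
    then have "\<not> length p \<le> 2"
      using common_neighbour_if_awalk[of x p y] no_common xy by blast
    then show "3 \<le> ereal (awalk_cost (\<lambda>_. 1) p)"
      by (simp add: awalk_cost_1)
  qed
  with xy that show thesis by blast
qed

theorem theorem4p13:
  shows "diameter (zd_commutativity_graph :: sedenion subspace_graph) = 3"
  unfolding diameter_def verts_zd_commutativity_graph
proof (rule antisym)
  show "(SUP x \<in> vertex_of ` (zero_divisors :: sedenion set).
      SUP y \<in> vertex_of ` zero_divisors. dist_zd x y) \<le> 3" (is "?D \<le> 3")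
    by (intro SUP_least, elim imageE) (simp only: dist_zd_sedenion_le_3)
  obtain x y :: sedenion where "x \<in> zero_divisors" "y \<in> zero_divisors"
    "3 \<le> dist_zd (vertex_of x) (vertex_of y)"
    using dist_zd_sedenion_ge_3 .
  then show "3 \<le> ?D"
    by (intro SUP_upper2[of "vertex_of x"] SUP_upper2[of "vertex_of y"]) simp_all
qed

end
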